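(* Let $\mathcal{Z}=\mathbb{R}^r$, $\mathcal{X}=\mathbb{R}^N$ with norms $\|\cdot\|_{\mathcal{Z}}$, $\|\cdot\|_{\mathcal{X}}$, and let $e\in C^1(\mathcal{X},\mathcal{Z})$ (encoder) and $d\in C^1(\mathcal{Z},\mathcal{X})$ (decoder) satisfy $e(d(\zeta))=\zeta$ for all $\zeta\in\mathcal{Z}$. Let a nonlinear port-Hamiltonian system on $\mathcal{Z}$ (see context) with Hamiltonian $\mathcal{H}$, initial value $z_0$, input $u$ and solution $z:\mathcal{T}\to\mathcal{Z}$ be given. Assume $U\subset\mathcal{Z}$ is a bounded open neighborhood such that (i) $z_0\in U$; (ii) $\mathcal{H}(\zeta)>\mathcal{H}(z_0)$ for all $\zeta\in\partial U$; (iii) $u(t)=0$ for all $t\in\mathcal{T}$. Then there exists $C_{\mathcal{Z}}\ge 0$ such that $\|z(t)-z_0\|_{\mathcal{Z}}\le C_{\mathcal{Z}}$ for all $t\in\mathcal{T}$. Moreover, if $d$ is continuously differentiable on the closure $\overline{U}$, then $d$ is Lipschitz continuous on $\overline{U}$ with Lipschitz constant $$L=\max_{\zeta\in\overline{U}}\|Dd(\zeta)\|,$$ in particular $\|d(z(t))-d(z_0)\|_{\mathcal{X}}\le L\,\|z(t)-z_0\|_{\mathcal{Z}}$ for all $t\in\mathcal{T}$, and the reconstructed solution $\tilde x(t)=d(z(t))$ with $\tilde x_0=d(z_0)$ is bounded on the state space by $$\|\tilde x(t)-\tilde x_0\|_{\mathcal{X}}=\|d(z(t))-d(z_0)\|_{\mathcal{X}}\le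 L\,\|z(t)-z_0\|_{\mathcal{Z}}\le L\,C_{\mathcal{Z}}\qquad\text{for all }t\in\mathcal{T}.$$
   Context: $\mathcal{T}=[0,t_{\mathrm{end}}]$ with $t_{\mathrm{end}}>0$; $u:\mathcal{T}\to\mathbb{R}^p$ is the input signal; $\partial U$ denotes the topological boundary of $U$ and $\overline{U}$ its closure; $Dd(\zeta)\in\mathbb{R}^{N\times r}$ is the Jacobian of $d$ at $\zeta$, and $\|Dd(\zeta)\|$ is its operator norm induced by $\|\cdot\|_{\mathcal{Z}}$ and $\|\cdot\|_{\mathcal{X}}$. A nonlinear port-Hamiltonian (pH) system on $\mathcal{Z}$ consists of a differentiable function $\mathcal{H}:\mathcal{Z}\to\mathbb{R}$ (the Hamiltonian) and continuous maps $J,R:\mathcal{Z}\to\mathbb{R}^{r\times r}$, $B:\mathcal{Z}\to\mathbb{R}^{r\times p}$ with $J(\zeta)=-J(\zeta)^{\top}$ and $R(\zeta)=R(\zeta)^{\top}\succeq 0$ for all $\zeta\in\mathcal{Z}$; it is the initial value problem with output $$\dot z(t)=\big(J(z(t))-R(z(t))\big)\nabla\mathcal{H}(z(t))+B(z(t))\,u(t),\quad z(0)=z_0,\qquad y(t)=B(z(t))^{\top}\nabla\mathcal{H}(z(t)).$$ A solution is a differentiable function $z:\mathcal{T}\to\mathcal{Z}$ satisfying the equations for all $t\in\mathcal{T}$.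
   Formalization: The estimates with the specific constant L = max‖Dd‖ are stated only when the closure of U is convex, as they can fail otherwise; without convexity, boundedness of z, existence of the maximum L and Lipschitz continuity of d with some constant are still asserted. *)

theory Defs
  imports "HOL-Analysis.Analysis"
begin

text \<open>The norms on the state space and on the latent space are arbitrary, hence in general
  different from the type-class norm of \<open>real ^ 'n\<close>, which is the Euclidean one. The type-class
  norm is used only for topological notions, on which all norms agree.\<close>

definition is_norm :: "('a::real_vector \<Rightarrow> real) \<Rightarrow> bool" where
  "is_norm \<nu> \<longleftrightarrow>
     (\<forall>x. 0 \<le> \<nu> x) \<and> (\<forall>x. \<nu> x = 0 \<longleftrightarrow> x = 0) \<and>
     (\<forall>a x. \<nu> (a *\<^sub>R x) = \<bar>a\<bar> * \<nu> x) \<and>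
     (\<forall>x y. \<nu> (x + y) \<le> \<nu> x + \<nu> y)"

text \<open>The analogue of \<^const>\<open>onorm\<close>; as there, the vector \<open>0\<close> contributes \<open>0 / 0 = 0\<close>.\<close>

definition induced_norm ::
    "(real ^ 'n \<Rightarrow> real) \<Rightarrow> (real ^ 'm \<Rightarrow> real) \<Rightarrow> real ^ 'n ^ 'm \<Rightarrow> real" where
  "induced_norm \<nu> \<mu> A = (SUP v. \<mu> (A *v v) / \<nu> v)"

text \<open>The analogue of \<^const>\<open>lipschitz_on\<close> for arbitrary norms.\<close>

definition lipschitz_wrt ::
    "('a::real_vector \<Rightarrow> real) \<Rightarrow> ('b::real_vector \<Rightarrow> real) \<Rightarrow> real \<Rightarrow> 'a set \<Rightarrow> ('a \<Rightarrow> 'b) \<Rightarrow> bool"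
  where
  "lipschitz_wrt \<nu> \<mu> L S f \<longleftrightarrow> 0 \<le> L \<and> (\<forall>x\<in>S. \<forall>y\<in>S. \<mu> (f x - f y) \<le> L * \<nu> (x - y))"

definition Jac :: "(real ^ 'n \<Rightarrow> real ^ 'm) \<Rightarrow> real ^ 'n \<Rightarrow> real ^ 'n ^ 'm" where
  "Jac f x = jacobian f (at x)"

definition C1_on :: "(real ^ 'n) set \<Rightarrow> (real ^ 'n \<Rightarrow> real ^ 'm) \<Rightarrow> bool" where
  "C1_on S f \<longleftrightarrow> (\<forall>x\<in>S. f differentiable (at x)) \<and> continuous_on S (Jac f)"

definition gradient :: "('a::real_inner \<Rightarrow> real) \<Rightarrow> 'a \<Rightarrow> 'a" where
  "gradient f x = (THE g. GDERIV f x :> g)"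

definition pos_semidef :: "real ^ 'n ^ 'n \<Rightarrow> bool" where
  "pos_semidef A \<longleftrightarrow> transpose A = A \<and> (\<forall>v. 0 \<le> v \<bullet> (A *v v))"

definition max_of :: "real set \<Rightarrow> real \<Rightarrow> bool" where
  "max_of S m \<longleftrightarrow> m \<in> S \<and> (\<forall>x\<in>S. x \<le> m)"

definition pH_system ::
    "(real ^ 'r \<Rightarrow> real) \<Rightarrow> (real ^ 'r \<Rightarrow> real ^ 'r ^ 'r) \<Rightarrow> (real ^ 'r \<Rightarrow> real ^ 'r ^ 'r) \<Rightarrow>
     (real ^ 'r \<Rightarrow> real ^ 'p ^ 'r) \<Rightarrow> bool" where
  "pH_system H J R B \<longleftrightarrow>
     (\<forall>\<zeta>. H differentiable (at \<zeta>)) \<and>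
     continuous_on UNIV J \<and> continuous_on UNIV R \<and> continuous_on UNIV B \<and>
     (\<forall>\<zeta>. J \<zeta> = - transpose (J \<zeta>)) \<and> (\<forall>\<zeta>. pos_semidef (R \<zeta>))"

definition pH_solution ::
    "(real ^ 'r \<Rightarrow> real) \<Rightarrow> (real ^ 'r \<Rightarrow> real ^ 'r ^ 'r) \<Rightarrow> (real ^ 'r \<Rightarrow> real ^ 'r ^ 'r) \<Rightarrow>
     (real ^ 'r \<Rightarrow> real ^ 'p ^ 'r) \<Rightarrow> real \<Rightarrow> (real \<Rightarrow> real ^ 'p) \<Rightarrow> real ^ 'r \<Rightarrow>
     (real \<Rightarrow> real ^ 'r) \<Rightarrow> (real \<Rightarrow> real ^ 'p) \<Rightarrow> bool" where
  "pH_solution H J R B tend u z0 z y \<longleftrightarrow>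
     (\<forall>t\<in>{0..tend}.
        (z has_vector_derivative
           ((J (z t) - R (z t)) *v gradient H (z t) + B (z t) *v u t)) (at t within {0..tend})) \<and>
     z 0 = z0 \<and>
     (\<forall>t\<in>{0..tend}. y t = transpose (B (z t)) *v gradient H (z t))"

end

theory Submission
  imports Defs
begin

text \<open>Without input the Hamiltonian is a Lyapunov function: along a solution the chain rule gives
  \<open>(H \<circ> z)' = \<nabla>H \<bullet> (J - R) \<nabla>H = - \<nabla>H \<bullet> R \<nabla>H \<le> 0\<close>, because the skew-symmetric part does no work
  (\<open>pH_energy_le_initial\<close>). So \<open>H (z t) \<le> H z0\<close>, whereas \<open>H > H z0\<close> on the frontier of \<open>U\<close>;
  the connected trajectory starts in \<open>U\<close>, cannot cross the frontier and stays in the bounded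
  set \<open>U\<close> (\<open>pH_stays_in_sublevel_neighborhood\<close>). This gives the constant \<open>CZ\<close>.

  The Lipschitz estimates come from the mean value inequality for arbitrary norms
  (\<open>lipschitz_wrt_induced_norm\<close>). It is deduced from the statement that the increment
  \<open>f b - f a\<close> lies in every closed convex set containing all the directional derivatives along the
  segment (\<open>mean_value_closed_convex\<close>), applied to a ball of the norm on the codomain. The maximum of
  \<open>\<zeta> \<mapsto> induced_norm nZ nX (Jac d \<zeta>)\<close> over a compact set exists because an induced norm is a continuous
  function of the matrix (\<open>continuous_on_induced_norm\<close>), which rests on the equivalence of all norms on
  a finite-dimensional space. The mean value inequality needs a convex set. If \<open>closure U\<close> is
  convex it yields \<open>L\<close> itself; in general it is applied on the convex hull of \<open>closure U\<close>, which
  is still compact, and yields some Lipschitz constant.\<close>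

section \<open>Norms on finite-dimensional spaces\<close>

lemma is_norm_nonneg: "is_norm \<nu> \<Longrightarrow> 0 \<le> \<nu> x"
  unfolding is_norm_def by (elim conjE) (erule spec)

lemma is_norm_eq_0: "is_norm \<nu> \<Longrightarrow> \<nu> x = 0 \<longleftrightarrow> x = 0"
  unfolding is_norm_def by (elim conjE) (erule spec)

lemma is_norm_scaleR: "is_norm \<nu> \<Longrightarrow> \<nu> (a *\<^sub>R x) = \<bar>a\<bar> * \<nu> x"
  unfolding is_norm_def by (elim conjE) (rule spec, erule spec)

lemma is_norm_triangle: "is_norm \<nu> \<Longrightarrow> \<nu> (x + y) \<le> \<nu> x + \<nu> y"
  unfolding is_norm_def by (elim conjE) (rule spec, erule spec)

lemma is_norm_minus:
  assumes "is_norm \<nu>" shows "\<nu> (- x) = \<nu> x"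
  using is_norm_scaleR[OF assms, of "-1" x] by simp

lemma is_norm_abs_diff:
  assumes "is_norm \<nu>" shows "\<bar>\<nu> x - \<nu> y\<bar> \<le> \<nu> (x - y)"
  using is_norm_triangle[OF assms, of "x - y" y] is_norm_triangle[OF assms, of "y - x" x]
    is_norm_minus[OF assms, of "x - y"] by simp

lemma is_norm_zero: "is_norm \<nu> \<Longrightarrow> \<nu> 0 = 0"
  by (simp only: is_norm_eq_0)

lemma is_norm_sum:
  assumes "is_norm \<nu>" shows "\<nu> (sum f A) \<le> (\<Sum>i\<in>A. \<nu> (f i))"
proof (induction A rule: infinite_finite_induct)
  case (insert i A)
  have "\<nu> (sum f (insert i A)) \<le> \<nu> (f i) + \<nu> (sum f A)"
    using is_norm_triangle[OF assms, of "f i" "sum f A"] insert.hyps by simp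
  also have "\<dots> \<le> \<nu> (f i) + (\<Sum>i\<in>A. \<nu> (f i))" using insert.IH by simp
  finally show ?case using insert.hyps by simp
qed (simp_all add: is_norm_zero[OF assms])

lemma is_norm_le_norm:
  fixes \<nu> :: "'a::euclidean_space \<Rightarrow> real"
  assumes "is_norm \<nu>"
  obtains b where "b \<ge> 0" "\<And>x. \<nu> x \<le> b * norm x"
proof
  show "(\<Sum>i\<in>Basis. \<nu> i) \<ge> 0" by (simp add: sum_nonneg is_norm_nonneg[OF assms])
  fix x :: 'a
  have "\<nu> x = \<nu> (\<Sum>i\<in>Basis. (x \<bullet> i) *\<^sub>R i)" by (simp add: euclidean_representation)
  also have "\<dots> \<le> (\<Sum>i\<in>Basis. \<bar>x \<bullet> i\<bar> * \<nu> i)"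
    using is_norm_sum[OF assms, of "\<lambda>i. (x \<bullet> i) *\<^sub>R i"] by (simp add: is_norm_scaleR[OF assms])
  also have "\<dots> \<le> (\<Sum>i\<in>Basis. norm x * \<nu> i)"
    by (rule sum_mono, rule mult_right_mono[OF Basis_le_norm is_norm_nonneg[OF assms]])
  also have "\<dots> = norm x * (\<Sum>i\<in>Basis. \<nu> i)" by (rule sum_distrib_left[symmetric])
  finally show "\<nu> x \<le> (\<Sum>i\<in>Basis. \<nu> i) * norm x" by (simp only: mult.commute)
qed

lemma continuous_on_is_norm:
  fixes \<nu> :: "'a::euclidean_space \<Rightarrow> real"
  assumes "is_norm \<nu>" shows "continuous_on S \<nu>"
proof -
  obtain b where b: "b \<ge> 0" "\<And>x. \<nu> x \<le> b * norm x" using is_norm_le_norm[OF assms] by blast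
  have "\<bar>\<nu> x - \<nu> y\<bar> \<le> b * norm (x - y)" for x y
    using is_norm_abs_diff[OF assms, of x y] b(2)[of "x - y"] by linarith
  then have "b-lipschitz_on S \<nu>"
    by (intro lipschitz_onI) (simp_all add: dist_norm b(1))
  then show ?thesis by (rule lipschitz_on_continuous_on)
qed

text \<open>The constant is the reciprocal of the minimum of \<open>\<nu>\<close> on the unit sphere, which is
  compact.\<close>

lemma norm_le_is_norm:
  fixes \<nu> :: "'a::euclidean_space \<Rightarrow> real"
  assumes "is_norm \<nu>"
  obtains c where "c \<ge> 0" "\<And>x. norm x \<le> c * \<nu> x"
proof -
  have "compact (sphere (0::'a) 1)" "sphere (0::'a) 1 \<noteq> {}" by simp_all
  from continuous_attains_inf[OF this continuous_on_is_norm[OF assms]]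
  obtain m :: 'a where m: "norm m = 1" "\<And>x. norm x = 1 \<Longrightarrow> \<nu> m \<le> \<nu> x"
    unfolding sphere_def mem_Collect_eq dist_0_norm by blast
  have "m \<noteq> 0" using m(1) by (metis norm_zero zero_neq_one)
  then have pos: "\<nu> m > 0"
    using is_norm_nonneg[OF assms, of m] is_norm_eq_0[OF assms, of m] by linarith
  have "norm x \<le> inverse (\<nu> m) * \<nu> x" for x
  proof (cases "x = 0")
    case True
    then show ?thesis by (simp add: is_norm_zero[OF assms])
  next
    case False
    then have "\<nu> m \<le> \<nu> ((1 / norm x) *\<^sub>R x)" by (intro m) simp
    also have "\<dots> = \<nu> x / norm x" by (simp add: is_norm_scaleR[OF assms])
    finally have "norm x * \<nu> m \<le> \<nu> x" using False by (simp add: pos_le_divide_eq mult.commute)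
    then have "norm x \<le> \<nu> x / \<nu> m" by (simp only: pos_le_divide_eq[OF pos])
    then show ?thesis by (simp only: divide_inverse mult.commute)
  qed
  then show ?thesis using less_imp_le[OF pos] by (intro that[of "inverse (\<nu> m)"]) simp_all
qed

section \<open>Induced matrix norms\<close>

lemma matrix_vector_mult_bound:
  obtains K where "K \<ge> 0"
    "\<And>(A :: real ^ 'n ^ 'm) x. norm (A *v x) \<le> norm A * norm x * K"
proof -
  have "bilinear (\<lambda>(A :: real ^ 'n ^ 'm) x. A *v x)"
    unfolding bilinear_def
    by (intro conjI allI linearI)
      (simp_all only: matrix_vector_mult_add_rdistrib scaleR_matrix_vector_assoc[symmetric]
        matrix_vector_right_distrib matrix_vector_mult_scaleR)
  then have "bounded_bilinear (\<lambda>(A :: real ^ 'n ^ 'm) x. A *v x)"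
    by (simp only: bilinear_conv_bounded_bilinear)
  from bounded_bilinear.nonneg_bounded[OF this] that show ?thesis by blast
qed

text \<open>This bounds the quotients whose supremum is the induced norm, and it also carries the
  continuity of the induced norm in the matrix.\<close>

lemma induced_norm_quotient_bound:
  fixes \<nu> :: "real ^ 'n \<Rightarrow> real" and \<mu> :: "real ^ 'm \<Rightarrow> real"
  assumes "is_norm \<nu>" "is_norm \<mu>"
  obtains C where "C \<ge> 0" "\<And>A v. \<mu> (A *v v) \<le> C * norm A * \<nu> v"
proof -
  obtain b where b: "b \<ge> 0" "\<And>x. \<mu> x \<le> b * norm x" using is_norm_le_norm[OF assms(2)] by blast
  obtain c where c: "c \<ge> 0" "\<And>x. norm x \<le> c * \<nu> x" using norm_le_is_norm[OF assms(1)] by blast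
  obtain K where K: "K \<ge> 0" "\<And>(A :: real ^ 'n ^ 'm) x. norm (A *v x) \<le> norm A * norm x * K"
    using matrix_vector_mult_bound by blast
  have "\<mu> (A *v v) \<le> (b * K * c) * norm A * \<nu> v" for A v
  proof -
    have "\<mu> (A *v v) \<le> b * norm (A *v v)" by (rule b)
    also have "\<dots> \<le> b * (norm A * norm v * K)" by (intro mult_left_mono K b)
    also have "\<dots> \<le> b * (norm A * (c * \<nu> v) * K)"
      by (intro mult_left_mono mult_right_mono K b c) auto
    finally show ?thesis by (simp add: ac_simps)
  qed
  moreover have "0 \<le> b * K * c" using b(1) c(1) K(1) by simp
  ultimately show ?thesis by (rule that[rotated])
qed

lemma divide_le_of_le_mult:
  fixes p q c :: real
  assumes "p \<le> c * q" "0 \<le> q" "0 \<le> c"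
  shows "p / q \<le> c"
proof (cases "q = 0")
  case False
  then have "0 < q" using assms(2) by linarith
  then show ?thesis using assms(1) by (simp only: pos_divide_le_eq)
qed (simp add: assms(3))

lemma induced_norm_bdd:
  fixes \<nu> :: "real ^ 'n \<Rightarrow> real" and \<mu> :: "real ^ 'm \<Rightarrow> real"
  assumes "is_norm \<nu>" "is_norm \<mu>"
  shows "bdd_above (range (\<lambda>v. \<mu> (A *v v) / \<nu> v))"
proof -
  obtain C where C: "C \<ge> 0" "\<And>A v. \<mu> (A *v v) \<le> C * norm A * \<nu> v"
    using induced_norm_quotient_bound[OF assms] by blast
  have "0 \<le> C * norm A" using C(1) by simp
  show ?thesis
    by (rule bdd_aboveI2)
      (rule divide_le_of_le_mult[OF C(2) is_norm_nonneg[OF assms(1)] \<open>0 \<le> C * norm A\<close>])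
qed

lemma induced_norm_bound:
  fixes \<nu> :: "real ^ 'n \<Rightarrow> real" and \<mu> :: "real ^ 'm \<Rightarrow> real"
  assumes "is_norm \<nu>" "is_norm \<mu>"
  shows "\<mu> (A *v v) \<le> induced_norm \<nu> \<mu> A * \<nu> v"
proof (cases "v = 0")
  case True
  then show ?thesis using is_norm_eq_0[OF assms(1), of 0] is_norm_eq_0[OF assms(2), of 0] by simp
next
  case False
  then have "\<nu> v > 0" using is_norm_nonneg[OF assms(1), of v] is_norm_eq_0[OF assms(1), of v] by simp
  moreover have "\<mu> (A *v v) / \<nu> v \<le> induced_norm \<nu> \<mu> A"
    unfolding induced_norm_def by (intro cSUP_upper induced_norm_bdd assms) auto
  ultimately show ?thesis by (simp add: divide_le_eq)
qed

lemma induced_norm_nonneg: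
  fixes \<nu> :: "real ^ 'n \<Rightarrow> real" and \<mu> :: "real ^ 'm \<Rightarrow> real"
  assumes "is_norm \<nu>" "is_norm \<mu>"
  shows "0 \<le> induced_norm \<nu> \<mu> A"
proof -
  \<comment> \<open>The zero vector always contributes the value \<open>0 / 0 = 0\<close> to the supremum.\<close>
  have "0 = \<mu> (A *v 0) / \<nu> 0" using is_norm_eq_0[OF assms(1), of 0] by simp
  also have "\<dots> \<le> induced_norm \<nu> \<mu> A"
    unfolding induced_norm_def by (intro cSUP_upper induced_norm_bdd assms) auto
  finally show ?thesis .
qed

lemma induced_norm_le:
  fixes \<nu> :: "real ^ 'n \<Rightarrow> real" and \<mu> :: "real ^ 'm \<Rightarrow> real"
  assumes "is_norm \<nu>" "0 \<le> c" "\<And>v. \<mu> (A *v v) \<le> c * \<nu> v"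
  shows "induced_norm \<nu> \<mu> A \<le> c"
proof -
  have "\<mu> (A *v v) / \<nu> v \<le> c" for v
    by (rule divide_le_of_le_mult[OF assms(3) is_norm_nonneg[OF assms(1)] assms(2)])
  then show ?thesis unfolding induced_norm_def by (intro cSUP_least) auto
qed

text \<open>In finite dimension the induced norm is dominated by the Euclidean norm of the matrix, so
  the triangle inequality makes it Lipschitz.\<close>

lemma continuous_on_induced_norm:
  fixes \<nu> :: "real ^ 'n \<Rightarrow> real" and \<mu> :: "real ^ 'm \<Rightarrow> real"
  assumes "is_norm \<nu>" "is_norm \<mu>"
  shows "continuous_on S (induced_norm \<nu> \<mu>)"
proof -
  obtain C where C: "C \<ge> 0" "\<And>A v. \<mu> (A *v v) \<le> C * norm A * \<nu> v"
    using induced_norm_quotient_bound[OF assms] by blast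
  have le: "induced_norm \<nu> \<mu> A \<le> induced_norm \<nu> \<mu> A' + C * norm (A - A')" for A A'
  proof (rule induced_norm_le[OF assms(1)])
    show "0 \<le> induced_norm \<nu> \<mu> A' + C * norm (A - A')"
      using C(1) induced_norm_nonneg[OF assms, of A'] by simp
    fix v
    have "A *v v = A' *v v + (A - A') *v v"
      by (simp add: matrix_vector_mult_add_rdistrib[symmetric])
    then have "\<mu> (A *v v) \<le> \<mu> (A' *v v) + \<mu> ((A - A') *v v)"
      using is_norm_triangle[OF assms(2)] by metis
    also have "\<dots> \<le> induced_norm \<nu> \<mu> A' * \<nu> v + C * norm (A - A') * \<nu> v"
      by (intro add_mono induced_norm_bound assms C)
    finally show "\<mu> (A *v v) \<le> (induced_norm \<nu> \<mu> A' + C * norm (A - A')) * \<nu> v"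
      by (simp add: distrib_right)
  qed
  have "\<bar>induced_norm \<nu> \<mu> A - induced_norm \<nu> \<mu> A'\<bar> \<le> C * norm (A - A')" for A A'
    using le[of A A'] le[of A' A] norm_minus_commute[of A A'] by (simp add: abs_le_iff)
  then have "C-lipschitz_on S (induced_norm \<nu> \<mu>)"
    by (intro lipschitz_onI) (simp_all add: dist_norm C(1))
  then show ?thesis by (rule lipschitz_on_continuous_on)
qed

section \<open>The mean value inequality for arbitrary norms\<close>

text \<open>If the increment were outside \<open>C\<close>, a hyperplane would separate it strictly from \<open>C\<close>, and the
  real mean value theorem for the corresponding linear functional of \<open>f\<close> would give a directional
  derivative on the wrong side.\<close>

lemma mean_value_closed_convex:
  fixes f :: "'a::real_normed_vector \<Rightarrow> 'b::euclidean_space"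
  assumes "closed C" "convex C" "convex S" "a \<in> S" "b \<in> S"
    and deriv: "\<And>x. x \<in> S \<Longrightarrow> (f has_derivative f' x) (at x within S)"
    and inC: "\<And>x. x \<in> S \<Longrightarrow> f' x (b - a) \<in> C"
  shows "f b - f a \<in> C"
proof (rule ccontr)
  assume "f b - f a \<notin> C"
  then obtain w c where w: "w \<bullet> (f b - f a) < c" "\<And>x. x \<in> C \<Longrightarrow> c < w \<bullet> x"
    using separating_hyperplane_closed_point[of C "f b - f a"] assms(1,2) by blast
  define p where "p t = a + t *\<^sub>R (b - a)" for t :: real
  have pS: "p t \<in> S" if "t \<in> {0..1}" for t
    using convexD_alt[OF \<open>convex S\<close> \<open>a \<in> S\<close> \<open>b \<in> S\<close>, of t] that
    by (simp add: p_def algebra_simps)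
  have "((\<lambda>t. w \<bullet> f (p t)) has_derivative (\<lambda>h. w \<bullet> f' (p t) (h *\<^sub>R (b - a)))) (at t within {0..1})"
    if "0 \<le> t" "t \<le> 1" for t
  proof -
    have dp: "(p has_derivative (\<lambda>h. h *\<^sub>R (b - a))) (at t within {0..1})"
      unfolding p_def by (auto intro!: derivative_eq_intros)
    have "(f has_derivative f' (p t)) (at (p t) within p ` {0..1})"
      using that pS by (intro has_derivative_subset[OF deriv]) auto
    from diff_chain_within[OF dp this] show ?thesis
      by (auto simp: o_def intro: has_derivative_inner_right)
  qed
  from mvt_very_simple[OF _ this] obtain t where t: "t \<in> {0..1}"
    "w \<bullet> f (p 1) - w \<bullet> f (p 0) = w \<bullet> f' (p t) (b - a)" by auto
  then have "w \<bullet> (f b - f a) = w \<bullet> f' (p t) (b - a)"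
    by (simp add: p_def inner_diff_right)
  with w(1) w(2)[OF inC[OF pS[OF t(1)]]] show False by linarith
qed

lemma lipschitz_wrt_induced_norm:
  fixes \<nu> :: "real ^ 'n \<Rightarrow> real" and \<mu> :: "real ^ 'm \<Rightarrow> real"
  assumes "is_norm \<nu>" "is_norm \<mu>" "convex S" "0 \<le> L"
    and diff: "\<And>x. x \<in> S \<Longrightarrow> f differentiable (at x)"
    and L: "\<And>x. x \<in> S \<Longrightarrow> induced_norm \<nu> \<mu> (Jac f x) \<le> L"
  shows "lipschitz_wrt \<nu> \<mu> L S f"
  unfolding lipschitz_wrt_def
proof (intro conjI ballI)
  fix a b assume ab: "a \<in> S" "b \<in> S"
  let ?C = "{v. \<mu> v \<le> L * \<nu> (a - b)}"
  have "closed ?C"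
    by (rule closed_Collect_le[OF continuous_on_is_norm[OF assms(2)] continuous_on_const])
  moreover have "convex ?C"
  proof (rule convexI)
    fix x y and s t :: real assume *: "x \<in> ?C" "y \<in> ?C" "0 \<le> s" "0 \<le> t" "s + t = 1"
    have "\<mu> (s *\<^sub>R x + t *\<^sub>R y) \<le> s * \<mu> x + t * \<mu> y"
      using is_norm_triangle[OF assms(2), of "s *\<^sub>R x" "t *\<^sub>R y"] *
      by (simp add: is_norm_scaleR[OF assms(2)])
    also have "\<dots> \<le> L * \<nu> (a - b)" using * by (intro convex_bound_le) auto
    finally show "s *\<^sub>R x + t *\<^sub>R y \<in> ?C" by simp
  qed
  moreover have "(f has_derivative (*v) (Jac f x)) (at x within S)" if "x \<in> S" for x
    using diff[OF that] unfolding Jac_def jacobian_works by (rule has_derivative_at_withinI)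
  moreover have "Jac f x *v (a - b) \<in> ?C" if "x \<in> S" for x
    using order_trans[OF induced_norm_bound[OF assms(1,2)]
        mult_right_mono[OF L[OF that] is_norm_nonneg[OF assms(1)]]] by simp
  ultimately have "f a - f b \<in> ?C"
    using mean_value_closed_convex[of ?C S b a f "\<lambda>x. (*v) (Jac f x)"] assms(3) ab by blast
  then show "\<mu> (f a - f b) \<le> L * \<nu> (a - b)" by simp
qed (rule assms)

lemma max_of_induced_norm_Jac:
  fixes \<nu> :: "real ^ 'n \<Rightarrow> real" and \<mu> :: "real ^ 'm \<Rightarrow> real"
  assumes "is_norm \<nu>" "is_norm \<mu>" "compact S" "S \<noteq> {}" "C1_on S f"
  obtains L where "max_of ((\<lambda>\<zeta>. induced_norm \<nu> \<mu> (Jac f \<zeta>)) ` S) L"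
proof -
  have "continuous_on S (\<lambda>\<zeta>. induced_norm \<nu> \<mu> (Jac f \<zeta>))"
    using assms(5) continuous_on_induced_norm[OF assms(1,2)]
    by (auto simp: C1_on_def intro: continuous_on_compose2[where t = UNIV])
  from continuous_attains_sup[OF assms(3,4) this] that show ?thesis
    unfolding max_of_def by blast
qed

lemma lipschitz_wrt_max_of_Jac:
  fixes \<nu> :: "real ^ 'n \<Rightarrow> real" and \<mu> :: "real ^ 'm \<Rightarrow> real"
  assumes "is_norm \<nu>" "is_norm \<mu>" "convex S" "C1_on S f"
    and "max_of ((\<lambda>\<zeta>. induced_norm \<nu> \<mu> (Jac f \<zeta>)) ` S) L"
  shows "lipschitz_wrt \<nu> \<mu> L S f"
proof (rule lipschitz_wrt_induced_norm[OF assms(1-3)])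
  show "0 \<le> L" using assms(5) induced_norm_nonneg[OF assms(1,2)] by (auto simp: max_of_def)
qed (use assms(4,5) in \<open>auto simp: C1_on_def max_of_def\<close>)

section \<open>Energy decay and confinement of the trajectory\<close>

lemma has_derivative_gradient:
  fixes f :: "'a::euclidean_space \<Rightarrow> real"
  assumes "f differentiable (at x)"
  shows "(f has_derivative (\<lambda>h. gradient f x \<bullet> h)) (at x)"
proof -
  obtain f' where f': "(f has_derivative f') (at x)" using assms by (auto simp: differentiable_def)
  then have "linear f'" by (rule has_derivative_linear)
  define g where "g = adjoint f' 1"
  have "f' = (\<lambda>h. h \<bullet> g)"
    using adjoint_works[OF \<open>linear f'\<close>, of _ 1] by (simp add: g_def fun_eq_iff)
  with f' have g: "GDERIV f x :> g" by (simp add: gderiv_def)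
  have "gradient f x = g"
    unfolding gradient_def
  proof (rule the_equality[where P = "\<lambda>g. GDERIV f x :> g", OF g])
    fix g' assume "GDERIV f x :> g'"
    with g have "(\<lambda>h. h \<bullet> g') = (\<lambda>h. h \<bullet> g)"
      unfolding gderiv_def by (rule has_derivative_unique[rotated])
    then have "\<forall>h. h \<bullet> g' = h \<bullet> g" by (intro allI) (rule fun_cong)
    then show "g' = g" by (rule vector_eq_ldot[THEN iffD1])
  qed
  with g show ?thesis by (simp add: gderiv_def inner_commute)
qed

lemma inner_skew_matrix:
  fixes A :: "real ^ 'n ^ 'n"
  assumes "A = - transpose A"
  shows "v \<bullet> (A *v v) = 0"
proof -
  have "v \<bullet> (A *v v) = (transpose A *v v) \<bullet> v"
    by (simp only: dot_lmul_matrix transpose_matrix_vector)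
  also have "transpose A = - A" using assms by (metis minus_minus)
  also have "- A *v v = - (A *v v)"
    using matrix_vector_mult_diff_rdistrib[of 0 A v] by simp
  also have "- (A *v v) \<bullet> v = - (v \<bullet> (A *v v))" by (simp add: inner_commute)
  finally show ?thesis by linarith
qed

lemma pH_energy_le_initial:
  assumes pH: "pH_system H J R B" and sol: "pH_solution H J R B tend u z0 z y"
    and u0: "\<And>t. t \<in> {0..tend} \<Longrightarrow> u t = 0" and t: "t \<in> {0..tend}"
  shows "H (z t) \<le> H z0"
proof -
  let ?g = "\<lambda>s. gradient H (z s)"
  let ?v = "\<lambda>s. (J (z s) - R (z s)) *v ?g s"
  have "((\<lambda>s. H (z s)) has_derivative (\<lambda>h. ?g s \<bullet> (h *\<^sub>R ?v s))) (at s within {0..t})"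
    if "0 \<le> s" "s \<le> t" for s
  proof -
    have s: "s \<in> {0..tend}" using that t by auto
    have "(z has_vector_derivative ?v s + B (z s) *v u s) (at s within {0..tend})"
      using sol s unfolding pH_solution_def by blast
    then have "(z has_vector_derivative ?v s) (at s within {0..tend})"
      by (simp only: u0[OF s] matrix_vector_mult_0_right add_0_right)
    then have dz: "(z has_derivative (\<lambda>h. h *\<^sub>R ?v s)) (at s within {0..t})"
      unfolding has_vector_derivative_def using t by (auto intro: has_derivative_subset)
    have "(H has_derivative (\<lambda>h. ?g s \<bullet> h)) (at (z s))"
      using pH by (intro has_derivative_gradient) (simp add: pH_system_def)
    from has_derivative_compose[OF dz this] show ?thesis .
  qed
  from mvt_very_simple[OF _ this] t
  obtain s where s: "s \<in> {0..t}" "H (z t) - H (z 0) = ?g s \<bullet> (t *\<^sub>R ?v s)" by auto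
  have "?g s \<bullet> ?v s = - (?g s \<bullet> (R (z s) *v ?g s))"
    using inner_skew_matrix[of "J (z s)" "?g s"] pH
    by (simp add: pH_system_def matrix_vector_mult_diff_rdistrib inner_diff_right)
  also have "\<dots> \<le> 0" using pH by (simp add: pH_system_def pos_semidef_def)
  finally have "?g s \<bullet> (t *\<^sub>R ?v s) \<le> 0" using t by (simp add: mult_nonneg_nonpos)
  with s(2) sol show ?thesis by (simp add: pH_solution_def)
qed

lemma pH_stays_in_sublevel_neighborhood:
  assumes pH: "pH_system H J R B" and sol: "pH_solution H J R B tend u z0 z y"
    and u0: "\<And>t. t \<in> {0..tend} \<Longrightarrow> u t = 0" and "z0 \<in> U"
    and front: "\<And>\<zeta>. \<zeta> \<in> frontier U \<Longrightarrow> H \<zeta> > H z0" and t: "t \<in> {0..tend}"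
  shows "z t \<in> U"
proof (rule ccontr)
  assume "z t \<notin> U"
  have "continuous_on {0..tend} z"
    using sol unfolding pH_solution_def
    by (intro continuous_on_vector_derivative) blast
  then have "connected (z ` {0..tend})"
    by (rule connected_continuous_image) simp
  moreover have "z 0 \<in> U" using sol \<open>z0 \<in> U\<close> by (simp add: pH_solution_def)
  then have "z 0 \<in> z ` {0..tend} \<inter> U" using t by simp
  moreover have "z t \<in> z ` {0..tend} - U"
    using \<open>z t \<notin> U\<close> t by simp
  ultimately have "z ` {0..tend} \<inter> frontier U \<noteq> {}"
    by (intro connected_Int_frontier) blast+
  then obtain s where "s \<in> {0..tend}" "z s \<in> frontier U" by blast
  with front[of "z s"] pH_energy_le_initial[OF pH sol u0, of s] show False by simp
qed

theorem mainTheorem5: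
  fixes nZ :: "real ^ 'r \<Rightarrow> real" and nX :: "real ^ 'N \<Rightarrow> real"
    and e :: "real ^ 'N \<Rightarrow> real ^ 'r" and d :: "real ^ 'r \<Rightarrow> real ^ 'N"
    and H :: "real ^ 'r \<Rightarrow> real"
    and J R :: "real ^ 'r \<Rightarrow> real ^ 'r ^ 'r" and B :: "real ^ 'r \<Rightarrow> real ^ 'p ^ 'r"
    and tend :: real and u :: "real \<Rightarrow> real ^ 'p"
    and z0 :: "real ^ 'r" and z :: "real \<Rightarrow> real ^ 'r" and y :: "real \<Rightarrow> real ^ 'p"
    and U :: "(real ^ 'r) set"
  assumes "is_norm nZ" and "is_norm nX"
    and "C1_on UNIV e" and "C1_on UNIV d" and "\<And>\<zeta>. e (d \<zeta>) = \<zeta>"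
    and "tend > 0"
    and "pH_system H J R B" and "pH_solution H J R B tend u z0 z y"
    and "bounded U" and "open U" and "z0 \<in> U"
    and "\<And>\<zeta>. \<zeta> \<in> frontier U \<Longrightarrow> H \<zeta> > H z0"
    and "\<And>t. t \<in> {0..tend} \<Longrightarrow> u t = 0"
  shows "\<exists>CZ\<ge>0.
    (\<forall>t\<in>{0..tend}. nZ (z t - z0) \<le> CZ) \<and>
    (C1_on (closure U) d \<longrightarrow>
      (\<exists>K. lipschitz_wrt nZ nX K (closure U) d) \<and>
      (\<exists>L. max_of ((\<lambda>\<zeta>. induced_norm nZ nX (Jac d \<zeta>)) ` closure U) L \<and>
        (convex (closure U) \<longrightarrow>
          lipschitz_wrt nZ nX L (closure U) d \<and>
          (\<forall>t\<in>{0..tend}. nX (d (z t) - d z0) \<le> L * nZ (z t - z0) \<and>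
                         L * nZ (z t - z0) \<le> L * CZ))))"
proof -
  have stay: "z t \<in> U" if "t \<in> {0..tend}" for t
    using pH_stays_in_sublevel_neighborhood[OF assms(7,8,13,11,12) that] .
  have z0_closure: "z0 \<in> closure U" using assms(11) closure_subset by blast
  have compact: "compact (closure U)" using assms(9) by (simp add: compact_closure)
  obtain b where b: "b \<ge> 0" "\<And>x. nZ x \<le> b * norm x" using is_norm_le_norm[OF assms(1)] by blast
  define CZ where "CZ = b * diameter U"
  have "CZ \<ge> 0" using b assms(9) by (simp add: CZ_def diameter_ge_0)
  have CZ: "nZ (z t - z0) \<le> CZ" if "t \<in> {0..tend}" for t
  proof -
    have "nZ (z t - z0) \<le> b * dist (z t) z0" using b(2) by (simp add: dist_norm)
    also have "\<dots> \<le> CZ"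
      unfolding CZ_def using assms(9,11) stay[OF that] b(1)
      by (intro mult_left_mono diameter_bounded_bound)
    finally show ?thesis .
  qed
  have C1: "C1_on S d" for S
    using assms(4) by (auto simp: C1_on_def intro: continuous_on_subset)
  have "\<exists>K. lipschitz_wrt nZ nX K (closure U) d"
  proof -
    let ?S = "convex hull closure U"
    have "compact ?S" "?S \<noteq> {}" using compact z0_closure by (auto intro: compact_convex_hull)
    then obtain K where "max_of ((\<lambda>\<zeta>. induced_norm nZ nX (Jac d \<zeta>)) ` ?S) K"
      using max_of_induced_norm_Jac[OF assms(1,2) _ _ C1] by blast
    then have "lipschitz_wrt nZ nX K ?S d"
      by (intro lipschitz_wrt_max_of_Jac assms C1 convex_convex_hull)
    then show ?thesis using hull_subset[of "closure U" convex] by (force simp: lipschitz_wrt_def)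
  qed
  moreover obtain L where L: "max_of ((\<lambda>\<zeta>. induced_norm nZ nX (Jac d \<zeta>)) ` closure U) L"
  proof (rule max_of_induced_norm_Jac[OF assms(1,2) compact _ C1])
    show "closure U \<noteq> {}" using z0_closure by (metis empty_iff)
  qed
  moreover have "nX (d (z t) - d z0) \<le> L * nZ (z t - z0) \<and> L * nZ (z t - z0) \<le> L * CZ"
    if "lipschitz_wrt nZ nX L (closure U) d" "t \<in> {0..tend}" for t
    using that z0_closure closure_subset[of U] stay[OF that(2)] CZ[OF that(2)]
    by (auto simp: lipschitz_wrt_def intro: mult_left_mono)
  ultimately show ?thesis
    using \<open>CZ \<ge> 0\<close> CZ lipschitz_wrt_max_of_Jac[OF assms(1,2) _ C1 L] by blast
qed

end
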